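(* Let $G$ be a set, $R_{=0}$ a subset of $\mathbb{Z}[G]$, and $t\in\mathbb{Z}[G]$. If the fact $t=0$ is proved in the dynamic local ring $(G;R_{=0})$, then it is also provable in the dynamic ring $(G;R_{=0})$. In other words, adding the axiom of local rings does not allow one to prove more facts of the form $t=0$.
   Context: $\mathbb{Z}[G]$ is the polynomial ring over $\mathbb{Z}$ with the elements of $G$ as indeterminates. Dynamic ring $(G;R_{=0})$: the elements of $R_{=0}$ are declared to be zero, and facts "$t=0$" with $t\in\mathbb{Z}[G]$ are derived by the rules: $\vdash 0=0$; $(x=0,\ y=0)\vdash x+y=0$; $x=0\vdash xy=0$. (Computations in $\mathbb{Z}[G]$ are done freely; $t=t'$ abbreviates $t-t'=0$.) So $t=0$ is provable if and only if $t$ lies in the ideal of $\mathbb{Z}[G]$ generated by $R_{=0}$. Dynamic local ring $(G;R_{=0})$: one may moreover use the axiom of local rings $$x+y=1\ \vdash\ (\exists u\ ux=1)\ \lor\ (\exists v\ vy=1)$$ in the following way. A dynamic evaluation is a finite tree. Each node carries a finite set $P$ of new parameters and a set of relations in $\mathbb{Z}[G\cup P]$; at the root $P=\emptyset$ and the relations are $R_{=0}$. At a node where an equality $a+b=1$ (with $a,b\in\mathbb{Z}[G\cup P]$) has been proved by the ring rules from the relations of the node, one may open two branches: in the first a fresh parameter $u$ and the relation $ua-1=0$ are added, in the second a fresh parameter $v$ and the relation $vb-1=0$ are added. A fact $t=0$ with $t\in\mathbb{Z}[G]$ is proved in the dynamic local ring if there is a dynamic evaluation such that, at every leaf, $t=0$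 is provable by the ring rules from the relations of the leaf. *)

theory Defs
  imports Complex_Main "HOL-Library.Poly_Mapping"
begin

text \<open>
  The elements of \<open>G\<close> have the arbitrary type \<open>'g\<close>. Dynamic evaluations need fresh parameters,
  and \<open>G\<close> may exhaust its type, so parameters are drawn from a disjoint infinite supply.
\<close>

datatype 'g indet = Gen 'g | Par nat

text \<open>
  The outer finitely supported function gives the integer coefficients of the monomials, the
  inner one the exponents of the indeterminates; addition and multiplication are those of the
  \<open>comm_ring_1\<close> instance for polynomial mappings (convolution product).
\<close>

type_synonym 'v int_mpoly = "('v \<Rightarrow>\<^sub>0 nat) \<Rightarrow>\<^sub>0 int"

definition indet_poly :: "'v \<Rightarrow> 'v int_mpoly" where
  "indet_poly x = Poly_Mapping.single (Poly_Mapping.single x 1) 1"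

text \<open>\<open>poly_ring V\<close> is \<open>\<int>[V]\<close>, as a subring of the polynomials in all indeterminates of type \<open>'v\<close>.\<close>

definition poly_ring :: "'v set \<Rightarrow> 'v int_mpoly set" where
  "poly_ring V = {p. \<forall>m \<in> Poly_Mapping.keys p. Poly_Mapping.keys m \<subseteq> V}"

text \<open>\<open>ring_provable V R t\<close>: the fact \<open>t = 0\<close> is derivable in the dynamic ring \<open>(V; R)\<close>.\<close>

inductive ring_provable :: "'v set \<Rightarrow> 'v int_mpoly set \<Rightarrow> 'v int_mpoly \<Rightarrow> bool"
  for V :: "'v set" and R :: "'v int_mpoly set"
where
  relation: "r \<in> R \<Longrightarrow> ring_provable V R r"
| zero: "ring_provable V R 0"
| add: "ring_provable V R x \<Longrightarrow> ring_provable V R y \<Longrightarrow> ring_provable V R (x + y)"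
| mult: "ring_provable V R x \<Longrightarrow> y \<in> poly_ring V \<Longrightarrow> ring_provable V R (x * y)"

definition indets :: "'g set \<Rightarrow> nat set \<Rightarrow> 'g indet set" where
  "indets G P = Gen ` G \<union> Par ` P"

text \<open>
  \<open>Branch a b u v T\<^sub>1 T\<^sub>2\<close> applies the axiom of local rings to \<open>a + b = 1\<close>, with \<open>u\<close> the parameter
  added in \<open>T\<^sub>1\<close> and \<open>v\<close> the one added in \<open>T\<^sub>2\<close>. The parameters \<open>P\<close> and relations \<open>R\<close> carried by
  each node are determined by those at the root, so they are not stored but passed along as
  arguments below.
\<close>

datatype 'g eval_tree =
  Leaf
| Branch "'g indet int_mpoly" "'g indet int_mpoly" nat nat "'g eval_tree" "'g eval_tree"

fun dynamic_evaluation ::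
  "'g set \<Rightarrow> nat set \<Rightarrow> 'g indet int_mpoly set \<Rightarrow> 'g eval_tree \<Rightarrow> bool"
where
  "dynamic_evaluation G P R Leaf \<longleftrightarrow> True"
| "dynamic_evaluation G P R (Branch a b u v T\<^sub>1 T\<^sub>2) \<longleftrightarrow>
     a \<in> poly_ring (indets G P) \<and> b \<in> poly_ring (indets G P) \<and>
     ring_provable (indets G P) R (a + b - 1) \<and>
     u \<notin> P \<and> v \<notin> P \<and>
     dynamic_evaluation G (insert u P) (insert (indet_poly (Par u) * a - 1) R) T\<^sub>1 \<and>
     dynamic_evaluation G (insert v P) (insert (indet_poly (Par v) * b - 1) R) T\<^sub>2"

fun leaves ::
  "nat set \<Rightarrow> 'g indet int_mpoly set \<Rightarrow> 'g eval_tree \<Rightarrow> (nat set \<times> 'g indet int_mpoly set) set"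
where
  "leaves P R Leaf = {(P, R)}"
| "leaves P R (Branch a b u v T\<^sub>1 T\<^sub>2) =
     leaves (insert u P) (insert (indet_poly (Par u) * a - 1) R) T\<^sub>1 \<union>
     leaves (insert v P) (insert (indet_poly (Par v) * b - 1) R) T\<^sub>2"

definition local_ring_provable ::
  "'g set \<Rightarrow> 'g indet int_mpoly set \<Rightarrow> 'g indet int_mpoly \<Rightarrow> bool"
where
  "local_ring_provable G R t \<longleftrightarrow>
     (\<exists>T. dynamic_evaluation G {} R T \<and>
        (\<forall>(P, S) \<in> leaves {} R T. ring_provable (indets G P) S t))"

end

theory Submission
  imports Defs
begin

text \<open>
  A use of the axiom of local rings at \<open>a + b = 1\<close> amounts to localizing the current ring
  \<open>A = \<int>[V] / I\<close> once at \<open>a\<close> and once at \<open>b\<close>: adjoining \<open>w\<close> with \<open>w * a = 1\<close> gives \<open>A[1/a]\<close>, and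
  the kernel of \<open>A \<rightarrow> A[1/a]\<close> consists of the elements killed by a power of \<open>a\<close>
  (\<open>ring_provable_adjoin_inverse\<close>). So a fact \<open>t = 0\<close> that holds in both branches yields
  \<open>a\<^sup>n * t = 0\<close> and \<open>b\<^sup>m * t = 0\<close> in \<open>A\<close>. As \<open>a + b = 1\<close>, powers of \<open>a\<close> and \<open>b\<close> are comaximal,
  whence \<open>t = 0\<close> already in \<open>A\<close> (\<open>ring_provable_comaximal_powers\<close>). Collapsing the branches of the
  tree one after the other, from the leaves to the root, proves the theorem.

  The statement on the kernel is obtained without constructing the localization. Substituting
  \<open>1/a\<close> for \<open>w\<close> and multiplying by \<open>a\<^sup>n\<close> is a polynomial operation on all polynomials of degree at
  most \<open>n\<close> in \<open>w\<close>. It sends \<open>w * a - 1\<close> to \<open>0\<close> and a polynomial \<open>t\<close> without \<open>w\<close> to \<open>t * a\<^sup>n\<close>, and it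
  transforms a derivation using \<open>w * a - 1 = 0\<close> into one that does not, provided \<open>n\<close> is large.
\<close>

section \<open>Polynomials in a given set of indeterminates\<close>

lemma poly_ring_0 [simp]: "0 \<in> poly_ring V"
  by (simp add: poly_ring_def)

lemma poly_ring_1 [simp]: "1 \<in> poly_ring V"
  by (simp add: poly_ring_def)

lemma poly_ring_add: "x \<in> poly_ring V \<Longrightarrow> y \<in> poly_ring V \<Longrightarrow> x + y \<in> poly_ring V"
  using Poly_Mapping.keys_add[of x y] unfolding poly_ring_def by blast

lemma poly_ring_uminus: "x \<in> poly_ring V \<Longrightarrow> - x \<in> poly_ring V"
  by (simp add: poly_ring_def)

lemma poly_ring_diff: "x \<in> poly_ring V \<Longrightarrow> y \<in> poly_ring V \<Longrightarrow> x - y \<in> poly_ring V"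
  using poly_ring_add[of x V "- y"] poly_ring_uminus[of y V] by simp

lemma poly_ring_mult:
  assumes "x \<in> poly_ring V" "y \<in> poly_ring V"
  shows "x * y \<in> poly_ring V"
  unfolding poly_ring_def
proof (intro CollectI ballI)
  fix m assume "m \<in> Poly_Mapping.keys (x * y)"
  then obtain p q where "m = p + q" "p \<in> Poly_Mapping.keys x" "q \<in> Poly_Mapping.keys y"
    using keys_mult[of x y] by blast
  then show "Poly_Mapping.keys m \<subseteq> V"
    using assms Poly_Mapping.keys_add[of p q] unfolding poly_ring_def by blast
qed

lemma poly_ring_power: "x \<in> poly_ring V \<Longrightarrow> x ^ n \<in> poly_ring V"
  by (induction n) (simp_all add: poly_ring_mult)

lemma poly_ring_single: "Poly_Mapping.keys m \<subseteq> V \<Longrightarrow> Poly_Mapping.single m c \<in> poly_ring V"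
  by (simp add: poly_ring_def)

lemma poly_ring_mono: "V \<subseteq> W \<Longrightarrow> poly_ring V \<subseteq> poly_ring W"
  unfolding poly_ring_def by blast

lemma poly_ring_indet: "x \<in> V \<Longrightarrow> indet_poly x \<in> poly_ring V"
  by (simp add: poly_ring_def indet_poly_def)

lemma sum_monomials:
  fixes x :: "'v int_mpoly"
  shows "(\<Sum>m\<in>Poly_Mapping.keys x. Poly_Mapping.single m (Poly_Mapping.lookup x m)) = x"
proof (rule poly_mapping_eqI)
  fix k
  have "Poly_Mapping.lookup (\<Sum>m\<in>Poly_Mapping.keys x. Poly_Mapping.single m (Poly_Mapping.lookup x m)) k
      = (\<Sum>m\<in>Poly_Mapping.keys x. if m = k then Poly_Mapping.lookup x m else 0)"
    by (simp add: lookup_sum lookup_single when_def)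
  also have "\<dots> = Poly_Mapping.lookup x k"
    by (simp add: in_keys_iff)
  finally show "Poly_Mapping.lookup
      (\<Sum>m\<in>Poly_Mapping.keys x. Poly_Mapping.single m (Poly_Mapping.lookup x m)) k
      = Poly_Mapping.lookup x k" .
qed

section \<open>Provable facts as an ideal\<close>

lemma ring_provable_diff:
  assumes "ring_provable V R x" "ring_provable V R y"
  shows "ring_provable V R (x - y)"
  using ring_provable.add[OF assms(1) ring_provable.mult[OF assms(2), of "- 1"]]
  by (simp add: poly_ring_uminus)

text \<open>
  Modulo provable equalities, \<open>a * s = 0\<close> means \<open>s = b * s\<close>, and hence \<open>s = b\<^sup>m * s\<close>.
\<close>

lemma ring_provable_cancel_power:
  assumes ab: "ring_provable V R (a + b - 1)" and b: "b \<in> poly_ring V" and s: "s \<in> poly_ring V"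
    and as: "ring_provable V R (s * a)"
  shows "ring_provable V R (s * b ^ m) \<Longrightarrow> ring_provable V R s"
proof (induction m)
  case 0
  then show ?case by simp
next
  case (Suc m)
  have "ring_provable V R (s * a * b ^ m + s * b ^ Suc m - (a + b - 1) * (s * b ^ m))"
    by (intro ring_provable_diff ring_provable.add ring_provable.mult as ab Suc.prems
        poly_ring_mult poly_ring_power b s)
  also have "s * a * b ^ m + s * b ^ Suc m - (a + b - 1) * (s * b ^ m) = s * b ^ m"
    by (simp add: algebra_simps)
  finally show ?case by (rule Suc.IH)
qed

lemma ring_provable_comaximal_powers:
  assumes ab: "ring_provable V R (a + b - 1)"
    and a: "a \<in> poly_ring V" and b: "b \<in> poly_ring V" and t: "t \<in> poly_ring V"
    and tb: "ring_provable V R (t * b ^ m)"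
  shows "ring_provable V R (t * a ^ n) \<Longrightarrow> ring_provable V R t"
proof (induction n)
  case 0
  then show ?case by simp
next
  case (Suc n)
  have "ring_provable V R (t * b ^ m * a ^ n)"
    by (intro ring_provable.mult tb poly_ring_power a)
  then have "ring_provable V R (t * a ^ n * b ^ m)"
    by (simp add: ac_simps)
  moreover have "ring_provable V R (t * a ^ n * a)"
    using Suc.prems by (simp add: ac_simps)
  ultimately have "ring_provable V R (t * a ^ n)"
    using ring_provable_cancel_power[OF ab b poly_ring_mult[OF t poly_ring_power[OF a]]] by blast
  then show ?case by (rule Suc.IH)
qed

section \<open>Substituting an inverse and clearing denominators\<close>

definition erase_indet :: "'v \<Rightarrow> ('v \<Rightarrow>\<^sub>0 nat) \<Rightarrow> ('v \<Rightarrow>\<^sub>0 nat)" where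
  "erase_indet w m = m - Poly_Mapping.single w (Poly_Mapping.lookup m w)"

text \<open>
  This is \<open>a\<^sup>n * x(w := 1/a)\<close> as long as \<open>n\<close> is at least the degree of \<open>x\<close> in \<open>w\<close>. For smaller
  \<open>n\<close> the truncated subtraction in the exponent keeps the map total and additive.
\<close>

definition subst_inverse :: "'v \<Rightarrow> 'v int_mpoly \<Rightarrow> nat \<Rightarrow> 'v int_mpoly \<Rightarrow> 'v int_mpoly" where
  "subst_inverse w a n x =
     (\<Sum>m\<in>Poly_Mapping.keys x. Poly_Mapping.single (erase_indet w m) (Poly_Mapping.lookup x m)
        * a ^ (n - Poly_Mapping.lookup m w))"

lemma erase_indet_add: "erase_indet w (m + m') = erase_indet w m + erase_indet w m'"
  by (rule poly_mapping_eqI)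
    (simp add: erase_indet_def lookup_add lookup_minus lookup_single when_def)

lemma erase_indet_id: "w \<notin> Poly_Mapping.keys m \<Longrightarrow> erase_indet w m = m"
  by (simp add: erase_indet_def in_keys_iff)

lemma keys_erase_indet: "Poly_Mapping.keys (erase_indet w m) = Poly_Mapping.keys m - {w}"
  by (auto simp: erase_indet_def in_keys_iff lookup_minus lookup_single when_def split: if_splits)

lemma subst_inverse_superset:
  assumes "finite A" "Poly_Mapping.keys x \<subseteq> A"
  shows "subst_inverse w a n x =
    (\<Sum>m\<in>A. Poly_Mapping.single (erase_indet w m) (Poly_Mapping.lookup x m)
        * a ^ (n - Poly_Mapping.lookup m w))"
  unfolding subst_inverse_def
  by (rule sum.mono_neutral_left) (use assms in \<open>auto simp: in_keys_iff\<close>)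

lemma subst_inverse_single:
  "subst_inverse w a n (Poly_Mapping.single m c) =
     Poly_Mapping.single (erase_indet w m) c * a ^ (n - Poly_Mapping.lookup m w)"
  by (subst subst_inverse_superset[of "{m}"]) auto

lemma subst_inverse_0 [simp]: "subst_inverse w a n 0 = 0"
  by (simp add: subst_inverse_def)

lemma subst_inverse_add:
  "subst_inverse w a n (x + y) = subst_inverse w a n x + subst_inverse w a n y"
proof -
  let ?A = "Poly_Mapping.keys x \<union> Poly_Mapping.keys y"
  have "Poly_Mapping.keys (x + y) \<subseteq> ?A"
    by (rule Poly_Mapping.keys_add)
  then show ?thesis
    by (simp add: subst_inverse_superset[of ?A] lookup_add single_add distrib_right sum.distrib)
qed

lemma subst_inverse_sum:
  "subst_inverse w a n (\<Sum>i\<in>A. f i) = (\<Sum>i\<in>A. subst_inverse w a n (f i))"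
  by (induction A rule: infinite_finite_induct) (simp_all add: subst_inverse_add)

lemma subst_inverse_id:
  assumes "x \<in> poly_ring V" "w \<notin> V"
  shows "subst_inverse w a n x = x * a ^ n"
proof -
  have w: "w \<notin> Poly_Mapping.keys m" if "m \<in> Poly_Mapping.keys x" for m
    using that assms by (auto simp: poly_ring_def)
  have "subst_inverse w a n x =
      (\<Sum>m\<in>Poly_Mapping.keys x. Poly_Mapping.single m (Poly_Mapping.lookup x m) * a ^ n)"
    unfolding subst_inverse_def
    by (rule sum.cong) (auto simp: erase_indet_id[OF w] dest: w simp: in_keys_iff[of w])
  then show ?thesis
    by (simp add: sum_distrib_right[symmetric] sum_monomials)
qed

text \<open>
  Each factor \<open>w\<close> of the monomial absorbs one factor \<open>a\<close>; the equality holds for every \<open>x\<close>, even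
  where the exponent in \<open>subst_inverse\<close> is truncated.
\<close>

lemma subst_inverse_monomial_mult:
  assumes "Poly_Mapping.lookup m w \<le> n"
  shows "subst_inverse w a n (Poly_Mapping.single m c * x) =
    Poly_Mapping.single (erase_indet w m) c * subst_inverse w a (n - Poly_Mapping.lookup m w) x"
proof -
  have "subst_inverse w a n (Poly_Mapping.single m c * x) =
      subst_inverse w a n (\<Sum>k\<in>Poly_Mapping.keys x.
        Poly_Mapping.single m c * Poly_Mapping.single k (Poly_Mapping.lookup x k))"
    by (simp add: sum_distrib_left[symmetric] sum_monomials)
  also have "\<dots> = (\<Sum>k\<in>Poly_Mapping.keys x. Poly_Mapping.single (erase_indet w m) c *
      (Poly_Mapping.single (erase_indet w k) (Poly_Mapping.lookup x k)
        * a ^ (n - Poly_Mapping.lookup m w - Poly_Mapping.lookup k w)))"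
    unfolding subst_inverse_sum
    by (simp add: mult_single subst_inverse_single erase_indet_add lookup_add
        mult.assoc[symmetric])
  finally show ?thesis
    by (simp add: subst_inverse_def sum_distrib_left)
qed

lemma subst_inverse_relation:
  assumes a: "a \<in> poly_ring V" and w: "w \<notin> V" and n: "n \<ge> 1"
  shows "subst_inverse w a n (indet_poly w * a - 1) = 0"
proof -
  have "erase_indet w (Poly_Mapping.single w 1) = 0"
    by (simp add: erase_indet_def)
  then have "subst_inverse w a n (indet_poly w * a) = a * a ^ (n - 1)"
    using n subst_inverse_id[OF a w]
      subst_inverse_monomial_mult[of "Poly_Mapping.single w 1" w n a 1 a]
    by (simp add: indet_poly_def)
  moreover have "subst_inverse w a n (- 1) = - (a ^ n)"
    using subst_inverse_id[of "- 1" V w a n] w by (simp add: poly_ring_uminus)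
  ultimately have "subst_inverse w a n (indet_poly w * a + - 1) = a * a ^ (n - 1) - a ^ n"
    by (simp only: subst_inverse_add) simp
  also have "\<dots> = 0"
    using n by (cases n) simp_all
  finally show ?thesis
    by simp
qed

text \<open>
  The bound on \<open>n\<close> is needed because multiplication by a monomial of degree \<open>k\<close> in \<open>w\<close> shifts
  \<open>n\<close> by \<open>k\<close>. Quantifying over all large \<open>n\<close> makes the property additive.
\<close>

lemma ring_provable_subst_inverse:
  assumes a: "a \<in> poly_ring V" and w: "w \<notin> V" and R: "R \<subseteq> poly_ring V"
    and x: "ring_provable (insert w V) (insert (indet_poly w * a - 1) R) x"
  shows "\<exists>N. \<forall>n\<ge>N. ring_provable V R (subst_inverse w a n x)"
  using x
proof induction
  case (relation r)
  then consider "r = indet_poly w * a - 1" | "r \<in> R"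
    by blast
  then show ?case
  proof cases
    case 1
    then have "\<forall>n\<ge>1. ring_provable V R (subst_inverse w a n r)"
      using subst_inverse_relation[OF a w] by (simp add: ring_provable.zero)
    then show ?thesis ..
  next
    case 2
    then have "subst_inverse w a n r = r * a ^ n" for n
      using R by (intro subst_inverse_id[OF _ w]) blast
    moreover have "ring_provable V R (r * a ^ n)" for n
      by (rule ring_provable.mult[OF ring_provable.relation[OF 2] poly_ring_power[OF a]])
    ultimately show ?thesis
      by simp
  qed
next
  case zero
  show ?case by (simp add: ring_provable.zero)
next
  case (add x y)
  then obtain N M where "\<forall>n\<ge>N. ring_provable V R (subst_inverse w a n x)"
      "\<forall>n\<ge>M. ring_provable V R (subst_inverse w a n y)"
    by blast
  then have "\<forall>n\<ge>max N M. ring_provable V R (subst_inverse w a n (x + y))"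
    unfolding subst_inverse_add by (auto intro: ring_provable.add)
  then show ?case ..
next
  case (mult x y)
  then obtain N where N: "\<And>n. n \<ge> N \<Longrightarrow> ring_provable V R (subst_inverse w a n x)"
    by blast
  let ?d = "\<Sum>m\<in>Poly_Mapping.keys y. Poly_Mapping.lookup m w"
  have "ring_provable V R (subst_inverse w a n (x * y))" if n: "n \<ge> N + ?d" for n
  proof -
    let ?y = "\<lambda>m. Poly_Mapping.single m (Poly_Mapping.lookup y m)"
    have summand: "ring_provable V R (subst_inverse w a n (?y m * x))"
      if m: "m \<in> Poly_Mapping.keys y" for m
    proof -
      have d: "Poly_Mapping.lookup m w \<le> ?d"
        by (rule member_le_sum) (use m in auto)
      have le: "Poly_Mapping.lookup m w \<le> n"
        using d n by linarith
      have "Poly_Mapping.keys m \<subseteq> insert w V"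
        using mult.hyps(2) m by (auto simp: poly_ring_def)
      then have c: "Poly_Mapping.single (erase_indet w m) (Poly_Mapping.lookup y m) \<in> poly_ring V"
        by (intro poly_ring_single) (auto simp: keys_erase_indet)
      have "ring_provable V R (subst_inverse w a (n - Poly_Mapping.lookup m w) x)"
        by (rule N) (use d n in linarith)
      from ring_provable.mult[OF this c] show ?thesis
        unfolding subst_inverse_monomial_mult[OF le] by (simp only: mult.commute)
    qed
    have sums: "ring_provable V R (\<Sum>m\<in>A. subst_inverse w a n (?y m * x))"
      if "A \<subseteq> Poly_Mapping.keys y" for A
      using finite_subset[OF that finite_keys] that
      by (induction A rule: finite_induct) (auto intro: ring_provable.zero ring_provable.add summand)
    have "x * y = (\<Sum>m\<in>Poly_Mapping.keys y. ?y m * x)"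
      by (metis sum_distrib_right sum_monomials mult.commute)
    then show ?thesis
      using sums[OF order_refl] by (simp add: subst_inverse_sum)
  qed
  then show ?case by blast
qed

text \<open>The kernel of a localization map: what becomes zero is killed by a power of \<open>a\<close>.\<close>

lemma ring_provable_adjoin_inverse:
  assumes "a \<in> poly_ring V" "w \<notin> V" "R \<subseteq> poly_ring V" "t \<in> poly_ring V"
    and "ring_provable (insert w V) (insert (indet_poly w * a - 1) R) t"
  shows "\<exists>n. ring_provable V R (t * a ^ n)"
proof -
  obtain n where "ring_provable V R (subst_inverse w a n t)"
    using ring_provable_subst_inverse[OF assms(1-3,5)] by blast
  then show ?thesis
    using subst_inverse_id[OF assms(4,2)] by auto
qed

section \<open>Collapsing a dynamic evaluation\<close>

lemma ring_provable_of_leaves: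
  assumes "R \<subseteq> poly_ring (indets G P)" "t \<in> poly_ring (indets G P)"
    and "dynamic_evaluation G P R T"
    and "\<And>Q S. (Q, S) \<in> leaves P R T \<Longrightarrow> ring_provable (indets G Q) S t"
  shows "ring_provable (indets G P) R t"
  using assms
proof (induction T arbitrary: P R)
  case Leaf
  then show ?case by simp
next
  case (Branch a b u v T1 T2)
  have a: "a \<in> poly_ring (indets G P)" and b: "b \<in> poly_ring (indets G P)"
    and ab: "ring_provable (indets G P) R (a + b - 1)"
    using Branch.prems(3) by simp_all
  have insert_Par: "indets G (insert i P) = insert (Par i) (indets G P)" for i
    by (auto simp: indets_def)
  have fresh: "Par u \<notin> indets G P" "Par v \<notin> indets G P"
    using Branch.prems(3) by (auto simp: indets_def)
  have lift: "poly_ring (indets G P) \<subseteq> poly_ring (indets G (insert i P))" for i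
    by (rule poly_ring_mono) (auto simp: insert_Par)
  have relations: "insert (indet_poly (Par i) * c - 1) R \<subseteq> poly_ring (indets G (insert i P))"
    if "c \<in> poly_ring (indets G P)" for i c
    using that lift[of i] Branch.prems(1) poly_ring_indet[of "Par i" "indets G (insert i P)"]
    by (auto simp: insert_Par intro!: poly_ring_diff poly_ring_mult)
  have "ring_provable (indets G (insert u P)) (insert (indet_poly (Par u) * a - 1) R) t"
    by (rule Branch.IH(1)) (use relations[OF a] lift Branch.prems in auto)
  then obtain n where n: "ring_provable (indets G P) R (t * a ^ n)"
    using ring_provable_adjoin_inverse[OF a fresh(1) Branch.prems(1,2)] by (auto simp: insert_Par)
  have "ring_provable (indets G (insert v P)) (insert (indet_poly (Par v) * b - 1) R) t"
    by (rule Branch.IH(2)) (use relations[OF b] lift Branch.prems in auto)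
  then obtain m where m: "ring_provable (indets G P) R (t * b ^ m)"
    using ring_provable_adjoin_inverse[OF b fresh(2) Branch.prems(1,2)] by (auto simp: insert_Par)
  show ?case
    by (rule ring_provable_comaximal_powers[OF ab a b Branch.prems(2) m n])
qed

theorem mainTheorem5:
  fixes G :: "'g set" and R0 :: "'g indet int_mpoly set" and t :: "'g indet int_mpoly"
  assumes "R0 \<subseteq> poly_ring (Gen ` G)"
    and "t \<in> poly_ring (Gen ` G)"
    and "local_ring_provable G R0 t"
  shows "ring_provable (Gen ` G) R0 t"
proof -
  have root: "indets G {} = Gen ` G"
    by (simp add: indets_def)
  obtain T where T: "dynamic_evaluation G {} R0 T"
      "\<And>Q S. (Q, S) \<in> leaves {} R0 T \<Longrightarrow> ring_provable (indets G Q) S t"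
    using assms(3) unfolding local_ring_provable_def by blast
  show ?thesis
    using ring_provable_of_leaves[of R0 G "{}" t T] assms(1,2) T by (simp add: root)
qed

end
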